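(* (1) The game $\mathrm{CN}(n,1)$ reduces to Nim, for which the set of losing positions is $\mathcal{L}=\{(p_1,p_2,\ldots,p_n)\mid p_1\oplus p_2\oplus\cdots\oplus p_n=0\}$. (2) The game $\mathrm{CN}(n,n)$ has a single losing position, namely $\mathcal{L}=\{(0,0,\ldots,0)\}$. (3) The game $\mathrm{CN}(n,n-1)$ has losing positions $\mathcal{L}=\{(a,a,\ldots,a)\mid a\ge 0\}$.
   Context: For integers $1\le k\le n$, circular Nim $\mathrm{CN}(n,k)$ is the following two-player impartial game. A position is a vector $\mathbf p=(p_1,\ldots,p_n)$ of non-negative integers, the heights of $n$ stacks of tokens placed in a circle in this order (indices modulo $n$). A legal move consists of choosing $k$ cyclically consecutive stacks $i,i+1,\ldots,i+k-1$ (modulo $n$) and removing $a_j$ tokens, $0\le a_j\le p_j$, from each chosen stack $j$, with at least one token removed in total. Players alternate; a player who cannot move loses. A position is losing (belongs to $\mathcal{L}$) if the player about to move from it loses under optimal play by the opponent; equivalently, $\mathcal{L}$ is the set of positions none of whose options (positions reachable by one legal move) lies in $\mathcal{L}$. Nim is the game played on several stacks of tokens in which the players alternately take one or more tokens from a single stack and the player who cannot move loses. The operator $\oplus$ is the digital sum: the integers are written in base $2$, added without carrying, and the result is read as an integer again. *)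

theory Defs
  imports Main
begin

text \<open>
  An impartial game is given by its relation \<open>move p q\<close> (``q is an option of p''). The predicates
  below speak about the player who is about to move: a position is won if some option is lost (for
  the opponent), and lost if every option is won. The least fixed point expresses that the
  respective winner can force the win in finitely many moves.
\<close>

inductive wins :: "('a \<Rightarrow> 'a \<Rightarrow> bool) \<Rightarrow> 'a \<Rightarrow> bool"
  and loses :: "('a \<Rightarrow> 'a \<Rightarrow> bool) \<Rightarrow> 'a \<Rightarrow> bool"
  for move :: "'a \<Rightarrow> 'a \<Rightarrow> bool"
where
  winsI: "move p q \<Longrightarrow> loses move q \<Longrightarrow> wins move p"
| losesI: "(\<And>q. move p q \<Longrightarrow> wins move q) \<Longrightarrow> loses move p"

text \<open>
  For terminating games this is the usual recursive characterization: a position is losing if and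
  only if none of its options is losing.
\<close>

lemma wins_iff: "wins move p \<longleftrightarrow> (\<exists>q. move p q \<and> loses move q)"
  by (subst wins.simps) blast

lemma loses_iff: "loses move p \<longleftrightarrow> (\<forall>q. move p q \<longrightarrow> wins move q)"
  by (subst loses.simps) blast

lemma wins_iff_not_loses:
  assumes "wf {(q, p). move p q}"
  shows "wins move p \<longleftrightarrow> \<not> loses move p"
  using assms
proof (induction p rule: wf_induct_rule)
  case (less p)
  have IH: "move p q \<Longrightarrow> wins move q \<longleftrightarrow> \<not> loses move q" for q
    using less by simp
  show ?case
    unfolding wins_iff [of move p] loses_iff [of move p] using IH by blast
qed

lemma loses_iff_no_option_loses:
  assumes "wf {(q, p). move p q}"
  shows "loses move p \<longleftrightarrow> (\<forall>q. move p q \<longrightarrow> \<not> loses move q)"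
  using loses_iff [of move p] wins_iff_not_loses [OF assms] by simp

text \<open>
  Positions with \<open>n\<close> stacks are lists of length \<open>n\<close>; stacks are numbered \<open>0, \<dots>, n - 1\<close>.
\<close>

definition circ_window :: "nat \<Rightarrow> nat \<Rightarrow> nat \<Rightarrow> nat set" where
  "circ_window n k i = {(i + t) mod n | t. t < k}"

definition cn_move :: "nat \<Rightarrow> nat \<Rightarrow> nat list \<Rightarrow> nat list \<Rightarrow> bool" where
  "cn_move n k p q \<longleftrightarrow>
     length p = n \<and>
     (\<exists>i<n. \<exists>a :: nat \<Rightarrow> nat.
        (\<forall>j\<in>circ_window n k i. a j \<le> p ! j) \<and>
        (\<exists>j\<in>circ_window n k i. 0 < a j) \<and>
        q = map (\<lambda>j. if j \<in> circ_window n k i then p ! j - a j else p ! j) [0..<n])"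

definition nim_move :: "nat list \<Rightarrow> nat list \<Rightarrow> bool" where
  "nim_move p q \<longleftrightarrow>
     (\<exists>i<length p. \<exists>a. 1 \<le> a \<and> a \<le> p ! i \<and> q = p[i := p ! i - a])"

definition cn_losing :: "nat \<Rightarrow> nat \<Rightarrow> nat list set" where
  "cn_losing n k = {p. length p = n \<and> loses (cn_move n k) p}"

definition nim_losing :: "nat \<Rightarrow> nat list set" where
  "nim_losing n = {p. length p = n \<and> loses nim_move p}"

definition digital_sum :: "nat list \<Rightarrow> nat" where
  "digital_sum p = foldr xor p 0"

lemma cn_move_decreases:
  assumes "cn_move n k p q"
  shows "length q = n" "sum_list q < sum_list p"
proof -
  from assms obtain i a where len: "length p = n" and i: "i < n"
    and le: "\<forall>j\<in>circ_window n k i. a j \<le> p ! j"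
    and pos: "\<exists>j\<in>circ_window n k i. 0 < a j"
    and q: "q = map (\<lambda>j. if j \<in> circ_window n k i then p ! j - a j else p ! j) [0..<n]"
    unfolding cn_move_def by blast
  show lq: "length q = n" using q by simp
  obtain j where j: "j \<in> circ_window n k i" "0 < a j" using pos by blast
  have jn: "j < n" using j(1) i by (auto simp: circ_window_def)
  have "q ! j < p ! j" using j le jn q by fastforce
  moreover have "\<forall>j<n. q ! j \<le> p ! j" using q by auto
  ultimately have "(\<Sum>j<n. q ! j) < (\<Sum>j<n. p ! j)"
    using jn by (intro sum_strict_mono_ex1) auto
  then show "sum_list q < sum_list p"
    using len lq by (simp add: sum_list_sum_nth atLeast0LessThan)
qed

lemma wf_cn_move: "wf {(q, p). cn_move n k p q}"
  by (rule wf_subset [OF wf_measure [of sum_list]]) (auto dest: cn_move_decreases)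

lemma cn_losing_iff:
  assumes "length p = n"
  shows "p \<in> cn_losing n k \<longleftrightarrow> (\<forall>q. cn_move n k p q \<longrightarrow> q \<notin> cn_losing n k)"
  using assms loses_iff_no_option_loses [OF wf_cn_move, of n k p] cn_move_decreases(1)
  unfolding cn_losing_def by blast

end

(*
  A set of positions is the set of losing positions as soon as no move stays inside it and every
  position outside it has a move into it. For Nim, the highest bit of a non-zero digital sum s occurs
  in some stack, and replacing the height x of that stack by x xor s is a legal move to digital sum 0.
  In CN(n,n) every non-zero position can be cleared at once. In CN(n,n-1) a move changes the position
  but leaves some stack untouched, so it never leads from one constant position to another; a
  non-constant position is levelled down to its minimum.
*)

theory Submission
  imports Defs
begin

section \<open>Characterizing losing positions\<close>

text \<open>By well-founded induction both sides agree on all options, so \<open>leave\<close> and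
  \<open>enter\<close> are exactly what the recursive characterization of \<open>loses\<close> asks
  for. The move-closed domain \<open>D\<close> allows restricting to lists of one fixed
  length.\<close>

lemma loses_iff_kernel:
  assumes wf: "wf {(q, p). move p q}"
    and closed: "\<And>p q. D p \<Longrightarrow> move p q \<Longrightarrow> D q"
    and leave: "\<And>p q. D p \<Longrightarrow> P p \<Longrightarrow> move p q \<Longrightarrow> \<not> P q"
    and enter: "\<And>p. D p \<Longrightarrow> \<not> P p \<Longrightarrow> \<exists>q. move p q \<and> P q"
    and "D p"
  shows "loses move p \<longleftrightarrow> P p"
  using wf \<open>D p\<close>
proof (induction p rule: wf_induct_rule)
  case (less p)
  have "loses move q \<longleftrightarrow> P q" if "move p q" for q
    using less that closed by simp
  then show ?case
    unfolding loses_iff_no_option_loses [OF wf, of p] using leave enter less.prems by blast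
qed

lemma cn_losing_eqI:
  assumes "\<And>p q. length p = n \<Longrightarrow> P p \<Longrightarrow> cn_move n k p q \<Longrightarrow> \<not> P q"
    and "\<And>p. length p = n \<Longrightarrow> \<not> P p \<Longrightarrow> \<exists>q. cn_move n k p q \<and> P q"
  shows "cn_losing n k = {p. length p = n \<and> P p}"
  using loses_iff_kernel [OF wf_cn_move, of "\<lambda>p. length p = n" n k P] cn_move_decreases(1) assms
  unfolding cn_losing_def by blast

section \<open>Circular windows and moves\<close>

text \<open>Eliminates the removal function: it can be recovered as the difference of the two
  positions, and removing at least one token then amounts to \<open>q \<noteq> p\<close>.\<close>

lemma cn_move_iff:
  "cn_move n k p q \<longleftrightarrow>
     length p = n \<and> length q = n \<and> q \<noteq> p \<and> (\<forall>j<n. q ! j \<le> p ! j) \<and>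
     (\<exists>i<n. \<forall>j<n. j \<notin> circ_window n k i \<longrightarrow> q ! j = p ! j)"
  (is "?L \<longleftrightarrow> ?R")
proof
  assume L: ?L
  then have "q \<noteq> p" using cn_move_decreases(2) by blast
  with L show ?R unfolding cn_move_def by fastforce
next
  assume R: ?R
  then obtain i where i: "i < n" and out: "\<And>j. j < n \<Longrightarrow> j \<notin> circ_window n k i \<Longrightarrow> q ! j = p ! j"
    by blast
  from R have len: "length p = n" "length q = n" and le: "\<And>j. j < n \<Longrightarrow> q ! j \<le> p ! j"
    by blast+
  obtain j where j: "j < n" "q ! j \<noteq> p ! j"
    using R nth_equalityI by metis
  have window: "j < n" if "j \<in> circ_window n k i" for j
    using that i by (auto simp: circ_window_def)
  have "j \<in> circ_window n k i" "0 < p ! j - q ! j"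
    using j out le [of j] by auto
  \<comment> \<open>The truncated double subtraction gives back \<open>q ! j\<close> because
    \<open>q ! j \<le> p ! j\<close>.\<close>
  moreover have "q = map (\<lambda>j. if j \<in> circ_window n k i then p ! j - (p ! j - q ! j) else p ! j) [0..<n]"
    using len le out by (intro nth_equalityI) auto
  ultimately show ?L
    unfolding cn_move_def using len i
    by (intro conjI exI [of _ i] exI [of _ "\<lambda>j. p ! j - q ! j"]) auto
qed

lemma circ_window_1: "i < n \<Longrightarrow> circ_window n 1 i = {i}"
  by (auto simp: circ_window_def)

text \<open>\<open>(j + n - i) mod n\<close> is the number of steps around the circle from
  \<open>i\<close> to \<open>j\<close>; adding \<open>n\<close> first prevents truncation when
  \<open>j < i\<close>.\<close>

lemma circ_window_eq:
  assumes "i < n"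
  shows "circ_window n k i = {j. j < n \<and> (j + n - i) mod n < k}"
proof (intro equalityI subsetI)
  fix j assume "j \<in> circ_window n k i"
  then obtain t where t: "t < k" "j = (i + t) mod n" by (auto simp: circ_window_def)
  have "(j + n - i) mod n = (j + (n - i)) mod n" using assms by simp
  also have "\<dots> = (i + t + (n - i)) mod n" unfolding t(2) by (rule mod_add_left_eq)
  also have "i + t + (n - i) = t + n" using assms by simp
  also have "(t + n) mod n \<le> t" by simp
  finally show "j \<in> {j. j < n \<and> (j + n - i) mod n < k}" using t assms by simp
next
  fix j assume j: "j \<in> {j. j < n \<and> (j + n - i) mod n < k}"
  have "(i + (j + n - i) mod n) mod n = (i + (j + n - i)) mod n" by (simp add: mod_add_right_eq)
  also have "\<dots> = j" using j assms by simp
  finally show "j \<in> circ_window n k i" using j unfolding circ_window_def by force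
qed

lemma cn_move_full_iff:
  assumes "1 \<le> n"
  shows "cn_move n n p q \<longleftrightarrow> length p = n \<and> length q = n \<and> q \<noteq> p \<and> (\<forall>j<n. q ! j \<le> p ! j)"
proof -
  have "circ_window n n 0 = {..<n}" using assms by (auto simp: circ_window_eq)
  then have "\<exists>i<n. \<forall>j<n. j \<notin> circ_window n n i \<longrightarrow> q ! j = p ! j"
    using assms by (intro exI [of _ 0]) auto
  then show ?thesis unfolding cn_move_iff by blast
qed

text \<open>Distances from \<open>i\<close> lie below \<open>n\<close>, so only the index at
  distance \<open>n - 1\<close>, the cyclic predecessor of \<open>i\<close>, is left out.\<close>

lemma circ_window_pred:
  assumes "i < n"
  shows "circ_window n (n - 1) i = {..<n} - {(i + n - 1) mod n}"
proof -
  have "(j + n - i) mod n < n - 1 \<longleftrightarrow> j \<noteq> (i + n - 1) mod n" if "j < n" for j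
  proof (cases "j < i")
    case True
    then show ?thesis using assms by (cases i) auto
  next
    case False
    then have "(j + n - i) mod n = (j - i + n) mod n" by simp
    also have "\<dots> = j - i" using that by simp
    finally have "(j + n - i) mod n = j - i" .
    then show ?thesis using assms that False by (cases i) auto
  qed
  then show ?thesis by (auto simp: circ_window_eq [OF assms])
qed

text \<open>Each window omits one stack and each stack is omitted by some window, so the window
  condition only demands one unchanged stack.\<close>

lemma cn_move_pred_iff:
  "cn_move n (n - 1) p q \<longleftrightarrow>
     length p = n \<and> length q = n \<and> q \<noteq> p \<and> (\<forall>j<n. q ! j \<le> p ! j) \<and> (\<exists>m<n. q ! m = p ! m)"
proof -
  have "(\<exists>i<n. \<forall>j<n. j \<notin> circ_window n (n - 1) i \<longrightarrow> q ! j = p ! j) \<longleftrightarrow> (\<exists>m<n. q ! m = p ! m)"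
    (is "?L \<longleftrightarrow> ?R")
  proof
    assume ?L
    then obtain i where i: "i < n" "\<And>j. j < n \<Longrightarrow> j \<notin> circ_window n (n - 1) i \<Longrightarrow> q ! j = p ! j"
      by blast
    have "(i + n - 1) mod n < n" "(i + n - 1) mod n \<notin> circ_window n (n - 1) i"
      using i(1) circ_window_pred [OF i(1)] by auto
    with i(2) show ?R by blast
  next
    assume ?R
    then obtain m where m: "m < n" "q ! m = p ! m" by blast
    \<comment> \<open>The window omitting \<open>m\<close> starts at its cyclic successor, which
      wraps to 0 for the last stack.\<close>
    have "(Suc m mod n + n - 1) mod n = m"
      using m(1) by (cases "Suc m = n") auto
    moreover have i: "Suc m mod n < n" using m(1) by simp
    ultimately have "circ_window n (n - 1) (Suc m mod n) = {..<n} - {m}"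
      using circ_window_pred by metis
    with i m show ?L by (intro exI [of _ "Suc m mod n"]) auto
  qed
  then show ?thesis unfolding cn_move_iff by blast
qed

section \<open>Losing positions of CN(n,n) and CN(n,n-1)\<close>

lemma cn_losing_full:
  assumes "1 \<le> n"
  shows "cn_losing n n = {replicate n 0}"
proof -
  have "cn_losing n n = {p. length p = n \<and> p = replicate n 0}"
  proof (rule cn_losing_eqI)
    fix p q assume "p = replicate n 0" "cn_move n n p q"
    then show "q \<noteq> replicate n 0" using assms by (auto simp: cn_move_full_iff)
  next
    fix p :: "nat list" assume "length p = n" "p \<noteq> replicate n 0"
    then show "\<exists>q. cn_move n n p q \<and> q = replicate n 0"
      using assms by (auto simp: cn_move_full_iff)
  qed
  also have "\<dots> = {replicate n 0}"
    by (intro equalityI subsetI) simp_all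
  finally show ?thesis .
qed

lemma cn_losing_pred:
  assumes "1 \<le> n"
  shows "cn_losing n (n - 1) = {replicate n a | a. a \<ge> 0}"
proof -
  have "cn_losing n (n - 1) = {p. length p = n \<and> (\<exists>a. p = replicate n a)}"
  proof (rule cn_losing_eqI)
    fix p q assume "\<exists>a. p = replicate n a" "cn_move n (n - 1) p q"
    then show "\<not> (\<exists>a. q = replicate n a)"
      unfolding cn_move_pred_iff by (metis nth_replicate)
  next
    fix p :: "nat list" assume p: "length p = n" "\<not> (\<exists>a. p = replicate n a)"
    have "p \<noteq> []" using p assms by auto
    then have "Min (set p) \<in> set p" by simp
    \<comment> \<open>A stack of minimal height keeps its height under levelling, so it serves as
      the unchanged stack.\<close>
    then obtain m where "m < n" "p ! m = Min (set p)" using p(1) by (metis in_set_conv_nth)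
    moreover have "replicate n (Min (set p)) \<noteq> p" using p(2) by metis
    ultimately have "cn_move n (n - 1) p (replicate n (Min (set p)))"
      using p(1) unfolding cn_move_pred_iff by auto
    then show "\<exists>q. cn_move n (n - 1) p q \<and> (\<exists>a. q = replicate n a)" by blast
  qed
  also have "\<dots> = {replicate n a | a. a \<ge> 0}"
    by (intro Collect_cong) (metis length_replicate zero_le)
  finally show ?thesis .
qed

section \<open>Nim moves and CN(n,1)\<close>

lemma nim_move_iff:
  "nim_move p q \<longleftrightarrow> (\<exists>i<length p. \<exists>x<p ! i. q = p[i := x])"
proof
  assume "nim_move p q"
  then obtain i a where ia: "i < length p" "1 \<le> a" "a \<le> p ! i" "q = p[i := p ! i - a]"
    unfolding nim_move_def by blast
  then have "p ! i - a < p ! i" by linarith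
  with ia show "\<exists>i<length p. \<exists>x<p ! i. q = p[i := x]" by blast
next
  assume "\<exists>i<length p. \<exists>x<p ! i. q = p[i := x]"
  then obtain i x where ix: "i < length p" "x < p ! i" "q = p[i := x]" by blast
  then have "1 \<le> p ! i - x" "p ! i - x \<le> p ! i" "q = p[i := p ! i - (p ! i - x)]" by auto
  with ix(1) show "nim_move p q" unfolding nim_move_def by blast
qed

text \<open>A window of length one is a single stack, so both games lower exactly one entry. This
  also transfers termination to Nim.\<close>

lemma cn_move_1_iff_nim_move:
  assumes "length p = n"
  shows "cn_move n 1 p q \<longleftrightarrow> nim_move p q"
proof
  assume "cn_move n 1 p q"
  then obtain i where i: "i < n" "\<And>j. j < n \<Longrightarrow> j \<notin> circ_window n 1 i \<Longrightarrow> q ! j = p ! j"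
    and q: "length q = n" "q \<noteq> p" "\<And>j. j < n \<Longrightarrow> q ! j \<le> p ! j"
    unfolding cn_move_iff by blast
  have eq: "q = p[i := q ! i]"
    using assms i q(1) circ_window_1 [OF i(1)] by (intro nth_equalityI) (auto simp: nth_list_update)
  then have "q ! i \<noteq> p ! i" using q(2) by (metis list_update_id)
  then have "q ! i < p ! i" using q(3) i(1) by (simp add: order_less_le)
  then show "nim_move p q" unfolding nim_move_iff using eq i(1) assms by blast
next
  assume "nim_move p q"
  then obtain i x where ix: "i < n" "x < p ! i" "q = p[i := x]"
    unfolding nim_move_iff using assms by blast
  then have "q ! i \<noteq> p ! i" using assms by simp
  then have "q \<noteq> p" by blast
  moreover have "\<forall>j<n. q ! j \<le> p ! j" "\<forall>j<n. j \<noteq> i \<longrightarrow> q ! j = p ! j"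
    using ix assms by (auto simp: nth_list_update)
  ultimately show "cn_move n 1 p q"
    unfolding cn_move_iff using ix assms circ_window_1 [OF ix(1)] by auto
qed

section \<open>Digital sums and binary digits\<close>

text \<open>Since \<open>xor\<close> is self-inverse, the first \<open>xor\<close> cancels the old
  height and the second inserts the new one.\<close>

lemma digital_sum_update:
  "i < length p \<Longrightarrow> digital_sum (p[i := x]) = xor (xor (digital_sum p) (p ! i)) x"
proof (induction p arbitrary: i)
  case (Cons a p)
  show ?case
  proof (cases i)
    case 0
    have "xor x s = xor (xor (xor a s) a) x" for s :: nat
      by (auto simp: bit_eq_iff bit_xor_iff)
    with 0 show ?thesis by (simp add: digital_sum_def)
  next
    case (Suc k)
    with Cons show ?thesis by (simp add: digital_sum_def xor.assoc)
  qed
qed simp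

lemma bit_digital_sum:
  "bit (digital_sum p) h \<Longrightarrow> \<exists>i<length p. bit (p ! i) h"
proof (induction p)
  case (Cons a p)
  then have "bit a h \<or> (\<exists>i<length p. bit (p ! i) h)"
    by (auto simp: digital_sum_def bit_xor_iff)
  then show ?case by force
qed (simp add: digital_sum_def)

text \<open>The highest differing bit decides the comparison. Halving both numbers lowers
  \<open>h\<close> by one; at \<open>h = 0\<close> the halves agree and parity decides.\<close>

lemma less_if_bit:
  fixes x y :: nat
  assumes "bit y h" "\<not> bit x h" "\<And>j. h < j \<Longrightarrow> bit x j = bit y j"
  shows "x < y"
  using assms
proof (induction h arbitrary: x y)
  case 0
  have "bit (x div 2) j = bit (y div 2) j" for j
    using 0(3) [of "Suc j"] by (simp add: bit_Suc)
  then have "x div 2 = y div 2" by (simp add: bit_eq_iff)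
  moreover have "odd y" "even x" using 0(1,2) by (simp_all add: bit_0)
  ultimately show ?case by presburger
next
  case (Suc h)
  have "bit (x div 2) j = bit (y div 2) j" if "h < j" for j
    using Suc.prems(3) [of "Suc j"] that by (simp add: bit_Suc)
  then have "x div 2 < y div 2"
    using Suc.prems(1,2) by (intro Suc.IH) (simp_all add: bit_Suc)
  then show ?case by presburger
qed

lemma highest_bit:
  fixes s :: nat
  assumes "s \<noteq> 0"
  obtains h where "bit s h" "\<And>j. h < j \<Longrightarrow> \<not> bit s j"
proof -
  \<comment> \<open>A set bit \<open>j\<close> forces \<open>2 ^ j \<le> s\<close>; this bound on
    the set bits is what makes \<open>Greatest\<close> meaningful.\<close>
  have "j \<le> s" if "bit s j" for j
  proof -
    have "s div 2 ^ j \<noteq> 0" using that by (metis bit_iff_odd even_zero)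
    then have "2 ^ j \<le> s" by (simp add: div_eq_0_iff)
    then show ?thesis using less_exp [of j] by linarith
  qed
  moreover have "\<exists>j. bit s j" using assms by (auto simp: bit_eq_iff)
  ultimately have "bit s (Greatest (bit s))" "\<And>j. bit s j \<Longrightarrow> j \<le> Greatest (bit s)"
    using GreatestI_ex_nat [of "bit s" s] Greatest_le_nat [of "bit s" _ s] by blast+
  then show ?thesis using that not_le by blast
qed

section \<open>Losing positions of Nim and CN(n,1)\<close>

text \<open>From sum zero, the new sum is the \<open>xor\<close> of the old and new heights of the
  changed stack, which differ.\<close>

lemma nim_move_digital_sum:
  assumes "nim_move p q" "digital_sum p = 0"
  shows "digital_sum q \<noteq> 0"
proof -
  obtain i x where "i < length p" "x < p ! i" "q = p[i := x]"
    using assms(1) unfolding nim_move_iff by blast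
  then have "digital_sum q = xor (p ! i) x" "x \<noteq> p ! i"
    using assms(2) by (simp_all add: digital_sum_update)
  then show ?thesis
    by (metis xor.assoc xor.left_neutral xor.right_neutral xor_self_eq)
qed

lemma ex_nim_move_digital_sum:
  assumes "digital_sum p \<noteq> 0"
  shows "\<exists>q. nim_move p q \<and> digital_sum q = 0"
proof -
  let ?s = "digital_sum p"
  obtain h where h: "bit ?s h" "\<And>j. h < j \<Longrightarrow> \<not> bit ?s j"
    using highest_bit [OF assms] by blast
  obtain i where i: "i < length p" "bit (p ! i) h"
    using bit_digital_sum [OF h(1)] by blast
  \<comment> \<open>Bit \<open>h\<close> is set in both operands and so gets cleared, while all bits
    above \<open>h\<close> are kept because \<open>?s\<close> has none there.\<close>
  have "xor (p ! i) ?s < p ! i"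
    using h i by (intro less_if_bit [of _ h]) (auto simp: bit_xor_iff)
  then have "nim_move p (p[i := xor (p ! i) ?s])"
    unfolding nim_move_iff using i(1) by blast
  moreover have "digital_sum (p[i := xor (p ! i) ?s]) = 0"
    using i(1) by (simp add: digital_sum_update xor.commute)
  ultimately show ?thesis by blast
qed

lemma wf_nim_move: "wf {(q, p). nim_move p q}"
proof (rule wf_subset [OF wf_measure [of sum_list]])
  have "sum_list q < sum_list p" if "nim_move p q" for p q
    \<comment> \<open>\<open>refl\<close> instantiates \<open>n\<close> with
      \<open>length p\<close>, so every Nim move is a move of circular Nim and lowers the token
      count.\<close>
    using that cn_move_1_iff_nim_move [OF refl] cn_move_decreases(2) by blast
  then show "{(q, p). nim_move p q} \<subseteq> measure sum_list" by auto
qed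

lemma nim_losing_eq: "nim_losing n = {p. length p = n \<and> digital_sum p = 0}"
proof -
  have "loses nim_move p \<longleftrightarrow> digital_sum p = 0" for p
    \<comment> \<open>The domain is trivial here, as \<open>nim_move\<close> carries no fixed number
      of stacks.\<close>
    using loses_iff_kernel [OF wf_nim_move, of "\<lambda>_. True" "\<lambda>p. digital_sum p = 0"]
      nim_move_digital_sum ex_nim_move_digital_sum by blast
  then show ?thesis by (simp add: nim_losing_def)
qed

lemma cn_losing_1: "cn_losing n 1 = {p. length p = n \<and> digital_sum p = 0}"
proof (rule cn_losing_eqI)
  fix p q assume "length p = n" "digital_sum p = 0" "cn_move n 1 p q"
  then show "digital_sum q \<noteq> 0"
    using cn_move_1_iff_nim_move nim_move_digital_sum by blast
next
  fix p assume "length p = n" "digital_sum p \<noteq> 0"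
  then show "\<exists>q. cn_move n 1 p q \<and> digital_sum q = 0"
    using cn_move_1_iff_nim_move ex_nim_move_digital_sum by blast
qed

theorem theorem2p1:
  fixes n :: nat
  assumes "1 \<le> n"
  shows "((\<forall>p q. length p = n \<longrightarrow> (cn_move n 1 p q \<longleftrightarrow> nim_move p q)) \<and>
          nim_losing n = {p. length p = n \<and> digital_sum p = 0} \<and>
          cn_losing n 1 = {p. length p = n \<and> digital_sum p = 0}) \<and>
         cn_losing n n = {replicate n 0} \<and>
         (2 \<le> n \<longrightarrow> cn_losing n (n - 1) = {replicate n a | a. a \<ge> 0})"
proof (intro conjI allI impI)
  show "cn_move n 1 p q \<longleftrightarrow> nim_move p q" if "length p = n" for p q
    using that by (rule cn_move_1_iff_nim_move)
qed (rule nim_losing_eq cn_losing_1 cn_losing_full [OF assms] cn_losing_pred [OF assms])+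

end
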